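(* Let $\Re=(S,(\mathcal K,\mathcal G),(X,\mathcal B),(\mathcal F,\mathcal T))$ be a Riesz system in which $S$ is a topological space quasi-normal under $(\mathcal K,\mathcal G)$, $X$ is a topological vector space, $\mathcal B$ is the family of closed, balanced, totally bounded subsets of $X$, and $\mathcal F\subseteq\mathcal C_p(S,X)$ is a topological vector space under $\mathcal T$, is a unital module over $\mathcal C_p(S)$ containing $X\otimes\mathcal C_{\mathcal K}(S)$, and $\mathcal T$ is coarser than (or equal to) the uniformity of uniform convergence on $S$. Let $Z$ be a topological vector space and $\ell:\mathcal F\to Z$ a map with $\ell(0)=0$. If $\ell$ has the Hammerstein property relative to $\mathcal E$, and, for each $B\in\mathcal B$, $\ell$ is uniformly continuous on $\mathcal F_B$ and maps $\mathcal F_B$ into a quasi-perfect, relatively complete subset of $Z$, then $\ell$ is a Riesz integral over $\Re$.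
   Context: Conventions. All topological and uniform spaces are Hausdorff. A family $\mathcal H$ of sets is closed under finite unions (intersections) if unions (intersections) of finite subfamilies belong to it, including $\bigcup\emptyset=\emptyset$ (respectively $\bigcap\emptyset:=\bigcup\mathcal H$). A uniform commutative monoid is a commutative monoid $(M,+)$ with identity $0$ and a uniformity for which $+$ is uniformly continuous; $\mathrm{unif}\,M$ is the base of the uniformity consisting of its members that are closed in $M\times M$, symmetric and translation invariant. A set is relatively complete if its closure is complete. A subset $E$ of $Z$ is quasi-perfect if, for every set $I$ and function $f:I\to Z$ all of whose finite partial sums $\sum_{i\in J}f(i)$ ($J\subseteq I$ finite) lie in $E$, the net of finite partial sums (indexed by finite $J\subseteq I$ ordered by inclusion) is Cauchy. Function spaces. $\mathcal C_p(S,X)$: continuous functions $S\to X$ with totally bounded range; $\mathcal C_p(S)$: the scalar-valued case; $\mathcal C_{\mathcal K}(S)$: continuous scalar functions with totally bounded range and support (complement of the union of the open sets on which the function vanishes) contained in some member of $\mathcal K$; $X\otimes\mathcal C_{\mathcal K}(S)$: the span of functions $xf$, $x\in X$, $f\in\mathcal C_{\mathcal K}(S)$. Quasi-normal: $S$ is quasi-normal under $(\mathcal K,\mathcal G)$ if $\mathcal K$ consists of closed sets, $\mathcal G$ of open sets, and conditions (1)–(4) below hold. Riesz system. $S$ is a non-empty set, $\mathcal K,\mathcal G$ are non-empty families of subsets of $S$, $X$ is a uniform commutative monoid, $\mathcal B$ a non-empty family of subsets of $X$, $\mathcal F$ a family of functions $S\to X$, $\mathcal T$ a uniformity on $\mathcal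 F$. $f\prec\alpha$ ("$f$ is supported by $\alpha$") means there is $\kappa\in\mathcal K$, $\kappa\subseteq\alpha$, with $f=0$ on $S\setminus\kappa$; $\alpha=_x f$ means there is $\gamma\in\mathcal G$, $\alpha\subseteq\gamma$, with $f=x$ on $\gamma$. $\mathcal B\text{-hull}(x)=\bigcap\{B\in\mathcal B:x\in B\}$; $\mathcal F_A=\{f\in\mathcal F:f(S)\subseteq A\}$. It is a Riesz system if: (1) $\mathcal K$ is closed under finite unions; (2) $\mathcal G$ is closed under finite intersections and finite unions; (3) $\kappa\setminus\gamma\in\mathcal K$, $\gamma\setminus\kappa\in\mathcal G$ for $\kappa\in\mathcal K,\gamma\in\mathcal G$; (4) for $\kappa\in\mathcal K$, $\gamma\in\mathcal G$, $\kappa\subseteq\gamma$ there are $\gamma'\in\mathcal G,\kappa'\in\mathcal K$ with $\kappa\subseteq\gamma'\subseteq\kappa'\subseteq\gamma$; (5) $\mathcal B$ is closed under arbitrary non-empty intersections and $0\in\bigcap\mathcal B$; (6) for $B,B'\in\mathcal B$ there is $C\in\mathcal B$ with $B+B'\subseteq C$; (7) each $x\in X$ lies in some $B\in\mathcal B$; (8) $\mathcal F$ contains the zero function and, with pointwise addition and $\mathcal T$, is a uniform commutative monoid; (9) each $f\in\mathcal F$ has range contained in some $B\in\mathcal B$; (10) for $f\in\mathcal F$, $W\in\mathrm{unif}\,X$ there is a finite $G\subseteq\mathcal G$ with $S=\bigcup G$ and $(f(s),f(t))\in W$ for all $\gamma\in G$, $s,t\in\gamma$; (11) for $\kappa\in\mathcal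 K,\gamma\in\mathcal G$, $\kappa\subseteq\gamma$, $x\in X$ there is $f\in\mathcal F$ with range in $\mathcal B\text{-hull}(x)$, $f\prec\gamma$ and $\kappa=_x f$; (12) for $B\in\mathcal B$, $T\in\mathcal T$ there is $U\in\mathrm{unif}\,X$ such that for all $\kappa\in\mathcal K$, $\gamma\in\mathcal G$ with $\kappa\subseteq\gamma$ and $f,g\in\mathcal F_B$ both supported by $\gamma$: if for some $\omega\in\mathcal G$ with $\kappa\subseteq\omega\subseteq\gamma$ one has $(f(s),g(s))\in U$ for all $s\in\omega$, then there are $p,q\in\mathcal F_B$ both supported by $\gamma\setminus\kappa$ with $(f+p,g+q)\in T$; (13) for $B\in\mathcal B$, finite $G\subseteq\mathcal G$, $\kappa\in\mathcal K$ with $\kappa\subseteq\bigcup G$ and $f\in\mathcal F_B$ there are $g_\gamma\in\mathcal F_B$ ($\gamma\in G$) with $g_\gamma\prec\gamma$, $\sum_{\gamma\in J}g_\gamma\in\mathcal F_B$ for all $J\subseteq G$, and $f=\sum_{\gamma\in G}g_\gamma$ on $\kappa$. Hammerstein property. $\mathcal E$ is the smallest field of subsets of $S$ containing $\mathcal K\cup\mathcal G$. $\ell$ has the Hammerstein property relative to $\mathcal E$ if $\ell(f+g_1+g_2)+\ell(f)=\ell(f+g_1)+\ell(f+g_2)$ for all $f,g_1,g_2\in\mathcal F$ for which there are disjoint $E_1,E_2\in\mathcal E$ with $g_i=0$ on $S\setminus E_i$, $i=1,2$. Riesz integral. $\ell:\mathcal F\to Z$ (with $\ell(0)=0$) is a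 Riesz integral over $\Re$ if: $\ell(f+g)=\ell(f)+\ell(g)$ whenever $f,g\in\mathcal F$ and $f\prec E$, $g\prec E'$ for some disjoint $E,E'\in\mathcal E$ ($\mathcal E$-additivity); for each $B\in\mathcal B$, $W\in\mathrm{unif}\,Z$ and disjoint sequence $(G_n)$ in $\mathcal G$ there is $m$ such that $(\ell(f),\ell(f+g))\in W$ for all $n>m$ and $f,g\in\mathcal F_B$ with $g\prec G_n$ ($s$-boundedness over $\mathcal B$); and for each $B\in\mathcal B$, $\ell$ is uniformly continuous on $\mathcal F_B$ and maps $\mathcal F_B$ onto a relatively complete subset of $Z$. *)

theory Defs
  imports "HOL-Analysis.Analysis" "HOL-Library.Function_Algebras"
begin

section \<open>Uniform commutative monoids and topological vector spaces\<close>

text \<open>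
  A (Hausdorff) uniform commutative monoid is a type of sort
  \<open>{uniform_topological_monoid_add, comm_monoid_add, t2_space}\<close>.
\<close>

definition unif_base :: "('m::{uniform_topological_monoid_add, comm_monoid_add} \<times> 'm) set set" where
  "unif_base = {W. eventually (\<lambda>p. p \<in> W) uniformity \<and> closed W \<and> sym W \<and>
                   (\<forall>x y z. (x, y) \<in> W \<longrightarrow> (x + z, y + z) \<in> W)}"

definition relatively_complete :: "'z::uniform_space set \<Rightarrow> bool" where
  "relatively_complete A \<longleftrightarrow> complete (closure A)"

text \<open>
  The index sets range over subsets of \<^typ>\<open>nat\<close>, since HOL cannot quantify over all types inside
  a formula. Lemma \<open>quasi_perfect_any_index\<close> below shows that the condition for these index sets
  implies the condition for index sets in an arbitrary type, so nothing is lost.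
\<close>

definition quasi_perfect :: "'z::{uniform_space, comm_monoid_add} set \<Rightarrow> bool" where
  "quasi_perfect E \<longleftrightarrow>
     (\<forall>(I :: nat set) f. (\<forall>J. finite J \<and> J \<subseteq> I \<longrightarrow> sum f J \<in> E) \<longrightarrow>
        cauchy_filter (filtermap (sum f) (finite_subsets_at_top I)))"

lemma cauchy_partial_sums_iff:
  fixes f :: "'i \<Rightarrow> 'z::{uniform_space, comm_monoid_add}"
  shows "cauchy_filter (filtermap (sum f) (finite_subsets_at_top I)) \<longleftrightarrow>
    (\<forall>P. eventually P uniformity \<longrightarrow>
      (\<exists>A. finite A \<and> A \<subseteq> I \<and>
        (\<forall>J J'. finite J \<and> A \<subseteq> J \<and> J \<subseteq> I \<and> finite J' \<and> A \<subseteq> J' \<and> J' \<subseteq> I \<longrightarrow>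
          P (sum f J, sum f J'))))" (is "?L \<longleftrightarrow> ?R")
proof
  assume L: ?L
  show ?R
  proof (intro allI impI)
    fix P :: "'z \<times> 'z \<Rightarrow> bool" assume "eventually P uniformity"
    with L have "eventually P (filtermap (sum f) (finite_subsets_at_top I) \<times>\<^sub>F
        filtermap (sum f) (finite_subsets_at_top I))"
      by (auto simp: cauchy_filter_def le_filter_def)
    then obtain Q where Q: "eventually Q (filtermap (sum f) (finite_subsets_at_top I))"
      and QP: "\<And>x y. Q x \<Longrightarrow> Q y \<Longrightarrow> P (x, y)"
      unfolding eventually_prod_same by auto
    from Q obtain A where "finite A" "A \<subseteq> I"
      "\<forall>J. finite J \<and> A \<subseteq> J \<and> J \<subseteq> I \<longrightarrow> Q (sum f J)"
      unfolding eventually_filtermap eventually_finite_subsets_at_top by auto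
    with QP show "\<exists>A. finite A \<and> A \<subseteq> I \<and>
        (\<forall>J J'. finite J \<and> A \<subseteq> J \<and> J \<subseteq> I \<and> finite J' \<and> A \<subseteq> J' \<and> J' \<subseteq> I \<longrightarrow>
          P (sum f J, sum f J'))"
      by (intro exI[of _ A]) simp
  qed
next
  assume R: ?R
  show ?L
    unfolding cauchy_filter_def le_filter_def
  proof (intro allI impI)
    fix P :: "'z \<times> 'z \<Rightarrow> bool" assume "eventually P uniformity"
    with R obtain A where A: "finite A" "A \<subseteq> I"
      "\<And>J J'. finite J \<Longrightarrow> A \<subseteq> J \<Longrightarrow> J \<subseteq> I \<Longrightarrow> finite J' \<Longrightarrow> A \<subseteq> J' \<Longrightarrow> J' \<subseteq> I \<Longrightarrow>
          P (sum f J, sum f J')"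
      by meson
    show "eventually P (filtermap (sum f) (finite_subsets_at_top I) \<times>\<^sub>F
        filtermap (sum f) (finite_subsets_at_top I))"
      unfolding eventually_prod_same eventually_filtermap
    proof (rule exI, rule conjI)
      show "\<forall>\<^sub>F K in finite_subsets_at_top I.
          (\<lambda>z. \<exists>J. finite J \<and> A \<subseteq> J \<and> J \<subseteq> I \<and> z = sum f J) (sum f K)"
        unfolding eventually_finite_subsets_at_top
        by (rule exI[of _ A], intro conjI allI impI) (use A(1,2) in blast)+
      show "\<forall>x y. (\<lambda>z. \<exists>J. finite J \<and> A \<subseteq> J \<and> J \<subseteq> I \<and> z = sum f J) x \<longrightarrow>
          (\<lambda>z. \<exists>J. finite J \<and> A \<subseteq> J \<and> J \<subseteq> I \<and> z = sum f J) y \<longrightarrow> P (x, y)"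
      proof (intro allI impI)
        fix x y
        assume "\<exists>J. finite J \<and> A \<subseteq> J \<and> J \<subseteq> I \<and> x = sum f J"
          and "\<exists>J. finite J \<and> A \<subseteq> J \<and> J \<subseteq> I \<and> y = sum f J"
        then show "P (x, y)" using A(3) by (elim exE conjE) simp
      qed
    qed
  qed
qed

lemma quasi_perfect_any_index:
  fixes E :: "'z::{uniform_space, comm_monoid_add} set" and I :: "'i set"
  assumes qp: "quasi_perfect E"
    and sums: "\<And>J. finite J \<Longrightarrow> J \<subseteq> I \<Longrightarrow> sum f J \<in> E"
  shows "cauchy_filter (filtermap (sum f) (finite_subsets_at_top I))"
proof (rule ccontr)
  assume "\<not> ?thesis"
  then obtain P where P: "eventually P uniformity"
    and no_A: "\<forall>A. finite A \<and> A \<subseteq> I \<longrightarrow> (\<exists>J J'. finite J \<and> A \<subseteq> J \<and> J \<subseteq> I \<and>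
          finite J' \<and> A \<subseteq> J' \<and> J' \<subseteq> I \<and> \<not> P (sum f J, sum f J'))"
    unfolding cauchy_partial_sums_iff by meson
  define Q where "Q A J J' \<longleftrightarrow> finite J \<and> A \<subseteq> J \<and> J \<subseteq> I \<and>
      finite J' \<and> A \<subseteq> J' \<and> J' \<subseteq> I \<and> \<not> P (sum f J, sum f J')" for A J J'
  have "\<forall>A. finite A \<and> A \<subseteq> I \<longrightarrow> (\<exists>J J'. Q A J J')"
    using no_A unfolding Q_def .
  then obtain j j' where "\<And>A. finite A \<and> A \<subseteq> I \<Longrightarrow> Q A (j A) (j' A)"
    by metis
  note jj = this[unfolded Q_def]
  define K where "K n = ((\<lambda>A. j A \<union> j' A) ^^ n) {}" for n
  have K_Suc: "K (Suc n) = j (K n) \<union> j' (K n)" for n by (simp add: K_def)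
  have K: "finite (K n) \<and> K n \<subseteq> I" for n
  proof (induction n)
    case 0
    show ?case by (simp add: K_def)
  next
    case (Suc n)
    from jj[OF Suc] show ?case by (simp add: K_Suc)
  qed
  have "K n \<subseteq> K (Suc n)" for n
    using jj[OF K[of n]] unfolding K_Suc by blast
  then have K_mono: "mono K"
    by (simp add: mono_iff_le_Suc)
  define C where "C = (\<Union>n. K n)"
  have C: "countable C" "C \<subseteq> I"
    using K unfolding C_def by (auto intro: countable_finite)
  define e where "e = to_nat_on C"
  define g where "g m = f (from_nat_into C m)" for m
  have inj: "inj_on e C" using inj_on_to_nat_on[OF C(1)] by (simp add: e_def)
  have sum_eq: "sum g (e ` J) = sum f J" if "J \<subseteq> C" for J
  proof -
    have "sum g (e ` J) = sum (g \<circ> e) J"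
      using that inj by (intro sum.reindex) (auto intro: inj_on_subset)
    also have "\<dots> = sum f J"
      using that C by (intro sum.cong) (auto simp: g_def e_def)
    finally show ?thesis .
  qed
  have lift: "\<exists>J. finite J \<and> J \<subseteq> C \<and> J' = e ` J" if "finite J'" "J' \<subseteq> e ` C" for J'
    using finite_subset_image[OF that] by blast
  have "\<forall>J. finite J \<and> J \<subseteq> e ` C \<longrightarrow> sum g J \<in> E"
  proof (intro allI impI)
    fix J assume "finite J \<and> J \<subseteq> e ` C"
    then obtain J0 where J0: "finite J0" "J0 \<subseteq> C" "J = e ` J0" using lift[of J] by metis
    then have "sum f J0 \<in> E" using C(2) by (intro sums) simp_all
    then show "sum g J \<in> E" using sum_eq[OF J0(2)] J0(3) by simp
  qed
  with qp have "cauchy_filter (filtermap (sum g) (finite_subsets_at_top (e ` C)))"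
    unfolding quasi_perfect_def by blast
  with P obtain A where A: "finite A" "A \<subseteq> e ` C"
    and AP: "\<And>J J'. finite J \<Longrightarrow> A \<subseteq> J \<Longrightarrow> J \<subseteq> e ` C \<Longrightarrow> finite J' \<Longrightarrow> A \<subseteq> J' \<Longrightarrow> J' \<subseteq> e ` C \<Longrightarrow>
        P (sum g J, sum g J')"
    unfolding cauchy_partial_sums_iff by meson
  obtain A0 where A0: "finite A0" "A0 \<subseteq> C" "A = e ` A0" using lift[OF A] by metis
  have "\<exists>n. A0 \<subseteq> K n"
    using A0(1,2)
  proof (induction A0)
    case (insert a A1)
    then obtain n m where "A1 \<subseteq> K n" "a \<in> K m" by (auto simp: C_def)
    then have "insert a A1 \<subseteq> K (max n m)"
      using monoD[OF K_mono, of n "max n m"] monoD[OF K_mono, of m "max n m"] by auto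
    then show ?case by blast
  qed auto
  then obtain n where n: "A0 \<subseteq> K n" ..
  have sub: "j (K n) \<subseteq> C" "j' (K n) \<subseteq> C"
    using K_Suc[of n] by (auto simp: C_def)
  have *: "finite (j (K n))" "finite (j' (K n))" "A0 \<subseteq> j (K n)" "A0 \<subseteq> j' (K n)"
    "\<not> P (sum f (j (K n)), sum f (j' (K n)))"
    using jj[OF K[of n]] order_trans[OF n] by simp_all
  have "P (sum g (e ` j (K n)), sum g (e ` j' (K n)))"
    by (rule AP) (simp_all add: A0(3) * sub image_mono)
  with * sub sum_eq show False by simp
qed

text \<open>
  The scalar field is the reals or the complex numbers; up to isomorphism these are the only
  types of class \<^class>\<open>real_normed_field\<close>. The uniformity of the sort below is the canonical one,
  because a uniformity for which addition and negation are uniformly continuous is determined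
  by its topology (\<open>uniformity = filtercomap (\<lambda>(x, y). y - x) (nhds 0)\<close>).
\<close>

locale topological_vector_space = vector_space scl
  for scl :: "'k::real_normed_field \<Rightarrow>
    'x::{uniform_topological_group_add, ab_group_add, t2_space} \<Rightarrow> 'x" +
  assumes continuous_scale: "continuous_on UNIV (\<lambda>(c, x). scl c x)"

text \<open>The empty set is excluded: a Riesz system requires \<open>0\<close> in every member of \<open>\<B>\<close>.\<close>

definition balanced :: "('k::real_normed_field \<Rightarrow> 'x \<Rightarrow> 'x) \<Rightarrow> 'x set \<Rightarrow> bool" where
  "balanced scl A \<longleftrightarrow> A \<noteq> {} \<and> (\<forall>c. norm c \<le> 1 \<longrightarrow> scl c ` A \<subseteq> A)"


section \<open>Uniformities on a set\<close>

text \<open>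
  A uniformity on a subset \<open>F\<close> of a type is a filter on pairs that is concentrated on \<open>F \<times> F\<close>.
\<close>

definition uniformity_on :: "'f set \<Rightarrow> ('f \<times> 'f) filter \<Rightarrow> bool" where
  "uniformity_on F \<T> \<longleftrightarrow>
     \<T> \<le> principal (F \<times> F) \<and>
     (\<forall>E. eventually E \<T> \<longrightarrow> (\<forall>f\<in>F. E (f, f))) \<and>
     (\<forall>E. eventually E \<T> \<longrightarrow> eventually (\<lambda>(f, g). E (g, f)) \<T>) \<and>
     (\<forall>E. eventually E \<T> \<longrightarrow>
        (\<exists>D. eventually D \<T> \<and> (\<forall>f g h. D (f, g) \<longrightarrow> D (g, h) \<longrightarrow> E (f, h))))"

definition hausdorff_uniformity_on :: "'f set \<Rightarrow> ('f \<times> 'f) filter \<Rightarrow> bool" where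
  "hausdorff_uniformity_on F \<T> \<longleftrightarrow> uniformity_on F \<T> \<and>
     (\<forall>f\<in>F. \<forall>g\<in>F. f \<noteq> g \<longrightarrow> (\<exists>E. eventually E \<T> \<and> \<not> E (f, g)))"

definition uniform_comm_monoid_on :: "'f::comm_monoid_add set \<Rightarrow> ('f \<times> 'f) filter \<Rightarrow> bool" where
  "uniform_comm_monoid_on F \<T> \<longleftrightarrow>
     0 \<in> F \<and> (\<forall>f\<in>F. \<forall>g\<in>F. f + g \<in> F) \<and> hausdorff_uniformity_on F \<T> \<and>
     filterlim (\<lambda>((f, f'), (g, g')). (f + g, f' + g')) \<T> (\<T> \<times>\<^sub>F \<T>)"

text \<open>The neighbourhood filter of \<open>f\<close> in the topology induced by \<open>\<T>\<close>.\<close>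

definition unif_nhds :: "('f \<times> 'f) filter \<Rightarrow> 'f \<Rightarrow> 'f filter" where
  "unif_nhds \<T> f = filtermap snd (inf \<T> (principal {p. fst p = f}))"

text \<open>
  As uniform continuity of addition is required here, \<open>\<T>\<close> is the canonical uniformity of its
  vector topology on \<open>F\<close>.
\<close>

definition tvs_on ::
  "('k::real_normed_field \<Rightarrow> 'f \<Rightarrow> 'f) \<Rightarrow> 'f::ab_group_add set \<Rightarrow> ('f \<times> 'f) filter \<Rightarrow> bool" where
  "tvs_on scl F \<T> \<longleftrightarrow>
     module.subspace scl F \<and> uniform_comm_monoid_on F \<T> \<and>
     (\<forall>c. \<forall>f\<in>F. filterlim (\<lambda>(c', g). scl c' g) (unif_nhds \<T> (scl c f))
                   (nhds c \<times>\<^sub>F unif_nhds \<T> f))"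

definition uniform_convergence_on ::
  "('s \<Rightarrow> 'x::uniform_space) set \<Rightarrow> (('s \<Rightarrow> 'x) \<times> ('s \<Rightarrow> 'x)) filter" where
  "uniform_convergence_on F =
     (INF W\<in>{W. eventually (\<lambda>p. p \<in> W) uniformity}.
        principal {(f, g). f \<in> F \<and> g \<in> F \<and> (\<forall>s. (f s, g s) \<in> W)})"


section \<open>Function spaces\<close>

definition Cp :: "('s::topological_space \<Rightarrow> 'y::uniform_space) set" where
  "Cp = {f. continuous_on UNIV f \<and> totally_bounded (range f)}"

definition supp :: "('s::topological_space \<Rightarrow> 'y::zero) \<Rightarrow> 's set" where
  "supp f = - \<Union>{U. open U \<and> (\<forall>s\<in>U. f s = 0)}"

definition CK :: "'s set set \<Rightarrow> ('s::topological_space \<Rightarrow> 'k::real_normed_field) set" where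
  "CK \<K> = {f \<in> Cp. \<exists>\<kappa>\<in>\<K>. supp f \<subseteq> \<kappa>}"

definition fun_scale :: "('k \<Rightarrow> 'x \<Rightarrow> 'x) \<Rightarrow> 'k \<Rightarrow> ('s \<Rightarrow> 'x) \<Rightarrow> ('s \<Rightarrow> 'x)" where
  "fun_scale scl c f = (\<lambda>s. scl c (f s))"

definition tensor_CK ::
  "('k::real_normed_field \<Rightarrow> 'x::ab_group_add \<Rightarrow> 'x) \<Rightarrow> 's::topological_space set set \<Rightarrow>
    ('s \<Rightarrow> 'x) set" where
  "tensor_CK scl \<K> =
     module.span (fun_scale scl) {(\<lambda>s. scl (h s) x) | x h. h \<in> CK \<K>}"

text \<open>
  Closure of \<open>F\<close> under the pointwise action of scalar functions; for an additive subgroup \<open>F\<close>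
  this makes \<open>F\<close> a unital module, as the module laws hold pointwise.
\<close>

definition unital_module_over_Cp ::
  "('k::real_normed_field \<Rightarrow> 'x::ab_group_add \<Rightarrow> 'x) \<Rightarrow> ('s::topological_space \<Rightarrow> 'x) set \<Rightarrow> bool" where
  "unital_module_over_Cp scl F \<longleftrightarrow>
     0 \<in> F \<and> (\<forall>f\<in>F. \<forall>g\<in>F. f + g \<in> F) \<and> (\<forall>f\<in>F. - f \<in> F) \<and>
     (\<forall>h\<in>Cp. \<forall>f\<in>F. (\<lambda>s. scl (h s) (f s)) \<in> F)"


section \<open>Riesz systems\<close>

definition fin_Union_closed :: "'s set set \<Rightarrow> bool" where
  "fin_Union_closed \<H> \<longleftrightarrow> (\<forall>H. finite H \<and> H \<subseteq> \<H> \<longrightarrow> \<Union>H \<in> \<H>)"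

text \<open>The empty intersection is \<open>\<Union>\<H>\<close> by convention.\<close>

definition fin_Inter_closed :: "'s set set \<Rightarrow> bool" where
  "fin_Inter_closed \<H> \<longleftrightarrow> \<Union>\<H> \<in> \<H> \<and> (\<forall>H. finite H \<and> H \<noteq> {} \<and> H \<subseteq> \<H> \<longrightarrow> \<Inter>H \<in> \<H>)"

locale riesz_pair =
  fixes \<K> \<G> :: "'s set set"
  assumes K_Union: "fin_Union_closed \<K>"
    and G_Inter: "fin_Inter_closed \<G>"
    and G_Union: "fin_Union_closed \<G>"
    and K_diff: "\<lbrakk>\<kappa> \<in> \<K>; \<gamma> \<in> \<G>\<rbrakk> \<Longrightarrow> \<kappa> - \<gamma> \<in> \<K>"
    and G_diff: "\<lbrakk>\<kappa> \<in> \<K>; \<gamma> \<in> \<G>\<rbrakk> \<Longrightarrow> \<gamma> - \<kappa> \<in> \<G>"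
    and interpolate: "\<lbrakk>\<kappa> \<in> \<K>; \<gamma> \<in> \<G>; \<kappa> \<subseteq> \<gamma>\<rbrakk> \<Longrightarrow>
      \<exists>\<gamma>'\<in>\<G>. \<exists>\<kappa>'\<in>\<K>. \<kappa> \<subseteq> \<gamma>' \<and> \<gamma>' \<subseteq> \<kappa>' \<and> \<kappa>' \<subseteq> \<gamma>"

definition quasi_normal :: "'s::topological_space set set \<Rightarrow> 's set set \<Rightarrow> bool" where
  "quasi_normal \<K> \<G> \<longleftrightarrow>
     (\<forall>\<kappa>\<in>\<K>. closed \<kappa>) \<and> (\<forall>\<gamma>\<in>\<G>. open \<gamma>) \<and> riesz_pair \<K> \<G>"

definition supported_by :: "'s set set \<Rightarrow> ('s \<Rightarrow> 'x::zero) \<Rightarrow> 's set \<Rightarrow> bool" where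
  "supported_by \<K> f \<alpha> \<longleftrightarrow> (\<exists>\<kappa>\<in>\<K>. \<kappa> \<subseteq> \<alpha> \<and> (\<forall>s\<in>- \<kappa>. f s = 0))"

definition equals_around :: "'s set set \<Rightarrow> 's set \<Rightarrow> 'x \<Rightarrow> ('s \<Rightarrow> 'x) \<Rightarrow> bool" where
  "equals_around \<G> \<alpha> x f \<longleftrightarrow> (\<exists>\<gamma>\<in>\<G>. \<alpha> \<subseteq> \<gamma> \<and> (\<forall>s\<in>\<gamma>. f s = x))"

definition point_hull :: "'x set set \<Rightarrow> 'x \<Rightarrow> 'x set" where
  "point_hull \<B> x = \<Inter>{B \<in> \<B>. x \<in> B}"

definition range_in :: "('s \<Rightarrow> 'x) set \<Rightarrow> 'x set \<Rightarrow> ('s \<Rightarrow> 'x) set" where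
  "range_in \<F> A = {f \<in> \<F>. range f \<subseteq> A}"

text \<open>
  The underlying set is the whole type \<^typ>\<open>'s\<close>, and the uniform commutative monoid is the type \<^typ>\<open>'x\<close>.
\<close>

locale riesz_system = riesz_pair \<K> \<G>
  for \<K> \<G> :: "'s set set" +
  fixes \<B> :: "'x::{uniform_topological_monoid_add, comm_monoid_add, t2_space} set set"
    and \<F> :: "('s \<Rightarrow> 'x) set"
    and \<T> :: "(('s \<Rightarrow> 'x) \<times> ('s \<Rightarrow> 'x)) filter"
  assumes K_nonempty: "\<K> \<noteq> {}"
    and G_nonempty: "\<G> \<noteq> {}"
    and B_nonempty: "\<B> \<noteq> {}"
    and B_Inter: "\<lbrakk>\<B>' \<subseteq> \<B>; \<B>' \<noteq> {}\<rbrakk> \<Longrightarrow> \<Inter>\<B>' \<in> \<B>"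
    and zero_in_B: "0 \<in> \<Inter>\<B>"
    and B_plus: "\<lbrakk>B \<in> \<B>; B' \<in> \<B>\<rbrakk> \<Longrightarrow> \<exists>C\<in>\<B>. {b + b' | b b'. b \<in> B \<and> b' \<in> B'} \<subseteq> C"
    and B_covers: "\<exists>B\<in>\<B>. x \<in> B"
    and F_monoid: "uniform_comm_monoid_on \<F> \<T>"
    and F_range: "f \<in> \<F> \<Longrightarrow> \<exists>B\<in>\<B>. range f \<subseteq> B"
    and F_small_oscillation: "\<lbrakk>f \<in> \<F>; W \<in> unif_base\<rbrakk> \<Longrightarrow>
      \<exists>G. finite G \<and> G \<subseteq> \<G> \<and> \<Union>G = UNIV \<and> (\<forall>\<gamma>\<in>G. \<forall>s\<in>\<gamma>. \<forall>t\<in>\<gamma>. (f s, f t) \<in> W)"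
    and F_separates: "\<lbrakk>\<kappa> \<in> \<K>; \<gamma> \<in> \<G>; \<kappa> \<subseteq> \<gamma>\<rbrakk> \<Longrightarrow>
      \<exists>f\<in>\<F>. range f \<subseteq> point_hull \<B> x \<and> supported_by \<K> f \<gamma> \<and> equals_around \<G> \<kappa> x f"
    and F_approximation: "\<lbrakk>B \<in> \<B>; eventually (\<lambda>p. p \<in> T) \<T>\<rbrakk> \<Longrightarrow>
      \<exists>U\<in>unif_base. \<forall>\<kappa>\<in>\<K>. \<forall>\<gamma>\<in>\<G>. \<kappa> \<subseteq> \<gamma> \<longrightarrow>
        (\<forall>f\<in>range_in \<F> B. \<forall>g\<in>range_in \<F> B.
           supported_by \<K> f \<gamma> \<and> supported_by \<K> g \<gamma> \<and>
           (\<exists>\<omega>\<in>\<G>. \<kappa> \<subseteq> \<omega> \<and> \<omega> \<subseteq> \<gamma> \<and> (\<forall>s\<in>\<omega>. (f s, g s) \<in> U)) \<longrightarrow>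
           (\<exists>p\<in>range_in \<F> B. \<exists>q\<in>range_in \<F> B.
              supported_by \<K> p (\<gamma> - \<kappa>) \<and> supported_by \<K> q (\<gamma> - \<kappa>) \<and> (f + p, g + q) \<in> T))"
    and F_decomposition: "\<lbrakk>B \<in> \<B>; finite G; G \<subseteq> \<G>; \<kappa> \<in> \<K>; \<kappa> \<subseteq> \<Union>G; f \<in> range_in \<F> B\<rbrakk> \<Longrightarrow>
      \<exists>g. (\<forall>\<gamma>\<in>G. g \<gamma> \<in> range_in \<F> B \<and> supported_by \<K> (g \<gamma>) \<gamma>) \<and>
          (\<forall>J\<subseteq>G. (\<Sum>\<gamma>\<in>J. g \<gamma>) \<in> range_in \<F> B) \<and>
          (\<forall>s\<in>\<kappa>. f s = (\<Sum>\<gamma>\<in>G. g \<gamma> s))"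


section \<open>The Hammerstein property and Riesz integrals\<close>

definition generated_field :: "'s set set \<Rightarrow> 's set set \<Rightarrow> 's set set" where
  "generated_field \<K> \<G> = \<Inter>{\<A>. algebra UNIV \<A> \<and> \<K> \<union> \<G> \<subseteq> \<A>}"

definition hammerstein ::
  "'s set set \<Rightarrow> ('s \<Rightarrow> 'x::comm_monoid_add) set \<Rightarrow> (('s \<Rightarrow> 'x) \<Rightarrow> 'z::comm_monoid_add) \<Rightarrow> bool" where
  "hammerstein \<E> \<F> l \<longleftrightarrow>
     (\<forall>f\<in>\<F>. \<forall>g\<^sub>1\<in>\<F>. \<forall>g\<^sub>2\<in>\<F>.
        (\<exists>E\<^sub>1\<in>\<E>. \<exists>E\<^sub>2\<in>\<E>. E\<^sub>1 \<inter> E\<^sub>2 = {} \<and> (\<forall>s\<in>- E\<^sub>1. g\<^sub>1 s = 0) \<and> (\<forall>s\<in>- E\<^sub>2. g\<^sub>2 s = 0)) \<longrightarrow>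
        l (f + g\<^sub>1 + g\<^sub>2) + l f = l (f + g\<^sub>1) + l (f + g\<^sub>2))"

definition E_additive ::
  "'s set set \<Rightarrow> 's set set \<Rightarrow> ('s \<Rightarrow> 'x::comm_monoid_add) set \<Rightarrow>
    (('s \<Rightarrow> 'x) \<Rightarrow> 'z::comm_monoid_add) \<Rightarrow> bool" where
  "E_additive \<K> \<E> \<F> l \<longleftrightarrow>
     (\<forall>f\<in>\<F>. \<forall>g\<in>\<F>.
        (\<exists>E\<in>\<E>. \<exists>E'\<in>\<E>. E \<inter> E' = {} \<and> supported_by \<K> f E \<and> supported_by \<K> g E') \<longrightarrow>
        l (f + g) = l f + l g)"

definition s_bounded ::
  "'s set set \<Rightarrow> 's set set \<Rightarrow> 'x set set \<Rightarrow> ('s \<Rightarrow> 'x::comm_monoid_add) set \<Rightarrow>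
    (('s \<Rightarrow> 'x) \<Rightarrow> 'z::{uniform_topological_monoid_add, comm_monoid_add}) \<Rightarrow> bool" where
  "s_bounded \<K> \<G> \<B> \<F> l \<longleftrightarrow>
     (\<forall>B\<in>\<B>. \<forall>W\<in>unif_base. \<forall>G :: nat \<Rightarrow> 's set.
        (\<forall>n. G n \<in> \<G>) \<and> disjoint_family G \<longrightarrow>
        (\<exists>m. \<forall>n>m. \<forall>f\<in>range_in \<F> B. \<forall>g\<in>range_in \<F> B.
            supported_by \<K> g (G n) \<longrightarrow> (l f, l (f + g)) \<in> W))"

definition uniformly_continuous_wrt ::
  "('f \<times> 'f) filter \<Rightarrow> 'f set \<Rightarrow> ('f \<Rightarrow> 'z::uniform_space) \<Rightarrow> bool" where
  "uniformly_continuous_wrt \<T> A l \<longleftrightarrow>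
     filterlim (\<lambda>(f, g). (l f, l g)) uniformity (inf \<T> (principal (A \<times> A)))"

definition riesz_integral ::
  "'s set set \<Rightarrow> 's set set \<Rightarrow> 'x set set \<Rightarrow> ('s \<Rightarrow> 'x::comm_monoid_add) set \<Rightarrow>
    (('s \<Rightarrow> 'x) \<times> ('s \<Rightarrow> 'x)) filter \<Rightarrow>
    (('s \<Rightarrow> 'x) \<Rightarrow> 'z::{uniform_topological_monoid_add, comm_monoid_add, t2_space}) \<Rightarrow> bool" where
  "riesz_integral \<K> \<G> \<B> \<F> \<T> l \<longleftrightarrow>
     l 0 = 0 \<and>
     E_additive \<K> (generated_field \<K> \<G>) \<F> l \<and>
     s_bounded \<K> \<G> \<B> \<F> l \<and>
     (\<forall>B\<in>\<B>. uniformly_continuous_wrt \<T> (range_in \<F> B) l \<and>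
             relatively_complete (l ` range_in \<F> B))"

end

theory Submission
  imports Defs
begin

text \<open>
  Additivity over \<open>\<E>\<close> is the Hammerstein identity at the base function \<open>0\<close>, and a closed subset
  of a complete set is complete; so the substance of the theorem is \<open>s\<close>-boundedness.

  Let \<open>g \<prec> \<gamma>\<close> with \<open>g = 0\<close> off \<open>\<kappa> \<subseteq> \<gamma>\<close>, where \<open>\<kappa> \<in> \<K>\<close>. The decomposition axiom of a Riesz
  system, for the single set \<open>\<gamma>\<close>, yields \<open>a \<prec> \<gamma>\<close> in \<open>\<F>\<^sub>B\<close> that agrees with \<open>f\<close> on \<open>\<kappa>\<close>. As \<open>g\<close> and \<open>f - a\<close> live on the
  complementary sets \<open>\<kappa>\<close> and \<open>- \<kappa>\<close> of \<open>\<E>\<close>, the Hammerstein property shows that passing from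
  \<open>f\<close> to \<open>f + g\<close> changes \<open>l\<close> by exactly as much as passing from \<open>a\<close> to \<open>a + g\<close>
  (\<open>hammerstein_localize\<close>). Both \<open>a\<close> and \<open>a + g\<close> are now supported by \<open>\<gamma>\<close>.

  If \<open>s\<close>-boundedness failed along a disjoint sequence \<open>G n\<close>, this would give, for infinitely many
  \<open>n\<close>, functions \<open>a n\<close> and \<open>b n = a n + g n\<close> supported by \<open>G n\<close> and with range in one member \<open>C\<close> of
  \<open>\<B>\<close>, such that \<open>l (a n)\<close> and \<open>l (b n)\<close> are not close. Finite sums of functions with disjoint
  supports again have range in \<open>C\<close>, and \<open>l\<close> is additive on them. So the finite partial sums of
  \<open>l (a n)\<close> stay in \<open>l ` \<F>\<^sub>C\<close>, hence in a quasi-perfect set, which forces all but finitely many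
  \<open>l (a n)\<close> into any given neighbourhood of \<open>0\<close> (\<open>disjoint_supports_vanish\<close>). The same holds for \<open>l (b n)\<close>, a contradiction.
\<close>

section \<open>Complete and quasi-perfect sets\<close>

lemma closed_subset_complete:
  fixes A :: "'a::uniform_space set"
  assumes "complete B" "closed A" "A \<subseteq> B"
  shows "complete A"
  unfolding complete_uniform
proof (intro allI impI)
  fix F assume F: "F \<le> principal A" "F \<noteq> bot" "cauchy_filter F"
  have "F \<le> principal B"
    using F(1) assms(3) by (meson order_trans principal_le_iff)
  with F assms(1) obtain x where x: "F \<le> nhds x"
    unfolding complete_uniform by blast
  have "x \<in> A"
  proof (rule ccontr)
    assume "x \<notin> A"
    then have "eventually (\<lambda>y. y \<in> - A) (nhds x)"
      using assms(2) by (intro eventually_nhds_in_open) (auto simp: open_closed)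
    then have "eventually (\<lambda>y. y \<in> - A) F"
      using x by (simp add: le_filter_def)
    moreover have "eventually (\<lambda>y. y \<in> A) F"
      using F(1) by (simp add: le_principal)
    ultimately have "eventually (\<lambda>_. False) F"
      by eventually_elim simp
    with F(2) show False by (simp add: eventually_False)
  qed
  with x show "\<exists>x\<in>A. F \<le> nhds x" by blast
qed

lemma relatively_complete_subset:
  "relatively_complete E \<Longrightarrow> A \<subseteq> E \<Longrightarrow> relatively_complete A"
  unfolding relatively_complete_def
  by (rule closed_subset_complete) (auto intro: closure_mono[THEN subsetD])

text \<open>
  Adding one more summand to a large finite partial sum changes it by that summand, so the Cauchy
  condition makes the summands small, uniformly outside a finite set.
\<close>

lemma quasi_perfect_summands_vanish:
  fixes E :: "'z::{uniform_topological_group_add, ab_group_add} set" and z :: "nat \<Rightarrow> 'z"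
  assumes qp: "quasi_perfect E"
    and sums: "\<And>J. finite J \<Longrightarrow> J \<subseteq> I \<Longrightarrow> sum z J \<in> E"
    and P: "eventually P (nhds 0)"
  shows "finite {n \<in> I. \<not> P (z n)}"
proof -
  have ev: "eventually (\<lambda>p. P (snd p - fst p)) uniformity"
    unfolding cauchy_seq_finset_iff_vanishing eventually_filtercomap
    using P by (intro exI[of _ P]) auto
  have "cauchy_filter (filtermap (sum z) (finite_subsets_at_top I))"
    using qp sums unfolding quasi_perfect_def by blast
  with ev obtain A where A: "finite A" "A \<subseteq> I"
    and close: "\<And>J J'. \<lbrakk>finite J; A \<subseteq> J; J \<subseteq> I; finite J'; A \<subseteq> J'; J' \<subseteq> I\<rbrakk> \<Longrightarrow>
        P (sum z J' - sum z J)"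
    unfolding cauchy_partial_sums_iff by (metis (mono_tags, lifting) fst_conv snd_conv)
  have "P (z n)" if "n \<in> I" "n \<notin> A" for n
    using close[of A "insert n A"] A that by (simp add: subset_insertI)
  then have "{n \<in> I. \<not> P (z n)} \<subseteq> A" by blast
  with A(1) show ?thesis by (rule finite_subset[rotated])
qed

section \<open>Additivity on functions with disjoint supports\<close>

lemma algebra_generated_field: "algebra UNIV (generated_field \<K> \<G>)"
  unfolding algebra_iff_Un[of UNIV "generated_field \<K> \<G>"]
  by (auto simp: generated_field_def algebra_iff_Un)

lemma subset_generated_field: "\<K> \<union> \<G> \<subseteq> generated_field \<K> \<G>"
  unfolding generated_field_def by blast

text \<open>Two functions with supports in disjoint members of \<open>\<E>\<close> are admissible increments at \<open>0\<close>.\<close>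

lemma hammerstein_imp_E_additive:
  fixes l :: "('s \<Rightarrow> 'x::comm_monoid_add) \<Rightarrow> 'z::comm_monoid_add"
  assumes "hammerstein \<E> \<F> l" "0 \<in> \<F>" "l 0 = 0"
  shows "E_additive \<K> \<E> \<F> l"
  unfolding E_additive_def
proof (intro ballI impI)
  fix f g assume fg: "f \<in> \<F>" "g \<in> \<F>"
    and "\<exists>E\<in>\<E>. \<exists>E'\<in>\<E>. E \<inter> E' = {} \<and> supported_by \<K> f E \<and> supported_by \<K> g E'"
  then obtain E E' where "E \<in> \<E>" "E' \<in> \<E>" "E \<inter> E' = {}"
    "\<forall>s\<in>- E. f s = 0" "\<forall>s\<in>- E'. g s = 0"
    unfolding supported_by_def by blast
  then have "l (0 + f + g) + l 0 = l (0 + f) + l (0 + g)"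
    using assms(1,2) fg unfolding hammerstein_def by blast
  then show "l (f + g) = l f + l g"
    using assms(3) by simp
qed

context riesz_pair
begin

lemma supported_by_mono: "supported_by \<K> f \<alpha> \<Longrightarrow> \<alpha> \<subseteq> \<beta> \<Longrightarrow> supported_by \<K> f \<beta>"
  unfolding supported_by_def by blast

lemma supported_by_zero: "supported_by \<K> 0 \<alpha>"
  unfolding supported_by_def
  using K_Union[unfolded fin_Union_closed_def, rule_format, of "{}"] by auto

lemma supported_by_add:
  fixes f g :: "'s \<Rightarrow> 'x::comm_monoid_add"
  assumes "supported_by \<K> f \<alpha>" "supported_by \<K> g \<alpha>"
  shows "supported_by \<K> (f + g) \<alpha>"
proof -
  obtain \<kappa> \<kappa>' where \<kappa>: "\<kappa> \<in> \<K>" "\<kappa> \<subseteq> \<alpha>" "\<forall>s\<in>- \<kappa>. f s = 0"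
      "\<kappa>' \<in> \<K>" "\<kappa>' \<subseteq> \<alpha>" "\<forall>s\<in>- \<kappa>'. g s = 0"
    using assms unfolding supported_by_def by blast
  have "\<Union>{\<kappa>, \<kappa>'} \<in> \<K>"
    using K_Union[unfolded fin_Union_closed_def, rule_format, of "{\<kappa>, \<kappa>'}"] \<kappa>(1,4) by simp
  then show ?thesis
    unfolding supported_by_def using \<kappa> by (intro bexI[of _ "\<kappa> \<union> \<kappa>'"]) auto
qed

text \<open>
  At each point at most one summand is nonzero, so a finite sum takes only values of its summands
  and the value \<open>0\<close>; in particular it keeps its range in \<open>B\<close>.
\<close>

lemma disjoint_supports_sum:
  fixes a :: "'i \<Rightarrow> 's \<Rightarrow> 'x::comm_monoid_add" and l :: "('s \<Rightarrow> 'x) \<Rightarrow> 'z::comm_monoid_add"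
  assumes zero: "0 \<in> \<F>" "0 \<in> B" and add: "\<And>f g. \<lbrakk>f \<in> \<F>; g \<in> \<F>\<rbrakk> \<Longrightarrow> f + g \<in> \<F>"
    and l: "l 0 = 0" "E_additive \<K> (generated_field \<K> \<G>) \<F> l"
    and G: "\<And>i. G i \<in> \<G>" "disjoint_family G"
    and a: "\<And>i. i \<in> J \<Longrightarrow> a i \<in> range_in \<F> B" "\<And>i. i \<in> J \<Longrightarrow> supported_by \<K> (a i) (G i)"
    and J: "finite J"
  shows "sum a J \<in> range_in \<F> B" "l (sum a J) = (\<Sum>i\<in>J. l (a i))"
proof -
  interpret E: algebra UNIV "generated_field \<K> \<G>"
    by (rule algebra_generated_field)
  have "sum a J \<in> range_in \<F> B \<and> supported_by \<K> (sum a J) (\<Union>i\<in>J. G i) \<and>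
      l (sum a J) = (\<Sum>i\<in>J. l (a i))"
    using J a
  proof (induction J)
    case empty
    have "(0 :: 's \<Rightarrow> 'x) \<in> range_in \<F> B"
      using zero by (simp add: range_in_def image_subset_iff)
    then show ?case
      unfolding sum.empty using l(1) supported_by_zero by blast
  next
    case (insert i J)
    let ?U = "\<Union>i\<in>J. G i"
    have IH: "sum a J \<in> range_in \<F> B" "supported_by \<K> (sum a J) ?U"
        "l (sum a J) = (\<Sum>i\<in>J. l (a i))"
      using insert by auto
    have ai: "a i \<in> range_in \<F> B" "supported_by \<K> (a i) (G i)"
      using insert.prems by auto
    have "G i \<inter> G j = {}" if "j \<in> J" for j
      using G(2) insert.hyps(2) that by (intro disjoint_family_onD[of G UNIV]) auto
    then have disj: "G i \<inter> ?U = {}"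
      by blast
    have "a i s + sum a J s \<in> B" for s
    proof -
      have "a i s = 0 \<or> sum a J s = 0"
        using ai(2) IH(2) disj unfolding supported_by_def by blast
      then show ?thesis
        using ai(1) IH(1) by (auto simp: range_in_def)
    qed
    then have "a i + sum a J \<in> range_in \<F> B"
      using ai(1) IH(1) add by (auto simp: range_in_def)
    moreover have "supported_by \<K> (a i + sum a J) (\<Union>i\<in>insert i J. G i)"
      by (intro supported_by_add supported_by_mono[OF ai(2)] supported_by_mono[OF IH(2)]) auto
    moreover have "l (a i + sum a J) = l (a i) + l (sum a J)"
    proof -
      have "G i \<in> generated_field \<K> \<G>" for i
        using G(1) subset_generated_field by blast
      moreover from this have "?U \<in> generated_field \<K> \<G>"
        using insert.hyps(1) by (intro E.finite_UN) auto
      ultimately show ?thesis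
        using l(2) ai IH(1,2) disj unfolding E_additive_def range_in_def by blast
    qed
    ultimately show ?case
      unfolding sum.insert[OF insert.hyps] IH(3) by blast
  qed
  then show "sum a J \<in> range_in \<F> B" "l (sum a J) = (\<Sum>i\<in>J. l (a i))"
    by auto
qed

lemma disjoint_supports_vanish:
  fixes a :: "nat \<Rightarrow> 's \<Rightarrow> 'x::comm_monoid_add"
    and l :: "('s \<Rightarrow> 'x) \<Rightarrow> 'z::{uniform_topological_group_add, ab_group_add}"
  assumes "0 \<in> \<F>" "0 \<in> B" "\<And>f g. \<lbrakk>f \<in> \<F>; g \<in> \<F>\<rbrakk> \<Longrightarrow> f + g \<in> \<F>"
    and "l 0 = 0" "E_additive \<K> (generated_field \<K> \<G>) \<F> l"
    and "\<And>n. G n \<in> \<G>" "disjoint_family G"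
    and a: "\<And>n. n \<in> I \<Longrightarrow> a n \<in> range_in \<F> B" "\<And>n. n \<in> I \<Longrightarrow> supported_by \<K> (a n) (G n)"
    and qp: "quasi_perfect E" "l ` range_in \<F> B \<subseteq> E"
    and P: "eventually P (nhds 0)"
  shows "finite {n \<in> I. \<not> P (l (a n))}"
proof (rule quasi_perfect_summands_vanish[OF qp(1) _ P])
  fix J assume J: "finite J" "J \<subseteq> I"
  have aJ: "a n \<in> range_in \<F> B" "supported_by \<K> (a n) (G n)" if "n \<in> J" for n
    using a that J(2) by auto
  note sum_J = disjoint_supports_sum[OF assms(1-7) aJ J(1)]
  show "(\<Sum>n\<in>J. l (a n)) \<in> E"
    using sum_J qp(2) by (metis image_subset_iff)
qed

end

section \<open>Boundedness on disjoint sequences\<close>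

text \<open>
  \<open>f = a + (f - a)\<close>, and \<open>f - a\<close> vanishes on \<open>\<kappa>\<close> while \<open>g\<close> vanishes off \<open>\<kappa>\<close>, so both are admissible
  increments at the base function \<open>a\<close>.
\<close>

lemma hammerstein_localize:
  fixes l :: "('s \<Rightarrow> 'x::ab_group_add) \<Rightarrow> 'z::ab_group_add"
  assumes "hammerstein \<E> \<F> l" "f \<in> \<F>" "a \<in> \<F>" "g \<in> \<F>" "f - a \<in> \<F>"
    and "\<kappa> \<in> \<E>" "- \<kappa> \<in> \<E>" "\<forall>s\<in>\<kappa>. f s = a s" "\<forall>s\<in>- \<kappa>. g s = 0"
  shows "l (f + g) - l f = l (a + g) - l a"
proof -
  have "l (a + g + (f - a)) + l a = l (a + g) + l (a + (f - a))"
    using assms(1)[unfolded hammerstein_def, rule_format, of a g "f - a"] assms(2-9)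
    by fastforce
  moreover have "a + g + (f - a) = f + g" "a + (f - a) = f"
    by (simp_all add: algebra_simps)
  ultimately show ?thesis
    by (simp add: algebra_simps)
qed

text \<open>
  Localization is what makes quasi-perfectness applicable: the functions \<open>f\<close> in the definition of
  \<open>s\<close>-boundedness vary with \<open>n\<close> and have overlapping supports, whereas their replacements \<open>a n\<close> can
  be summed over \<open>n\<close> without leaving a common member of \<open>\<B>\<close>.
\<close>

lemma (in riesz_pair) s_bounded_if_localizable:
  fixes l :: "('s \<Rightarrow> 'x::ab_group_add) \<Rightarrow> 'z::{uniform_topological_group_add, ab_group_add}"
  assumes zero: "0 \<in> \<F>" "\<And>B. B \<in> \<B> \<Longrightarrow> 0 \<in> B"
    and add: "\<And>f g. \<lbrakk>f \<in> \<F>; g \<in> \<F>\<rbrakk> \<Longrightarrow> f + g \<in> \<F>"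
    and diff: "\<And>f g. \<lbrakk>f \<in> \<F>; g \<in> \<F>\<rbrakk> \<Longrightarrow> f - g \<in> \<F>"
    and B_plus: "\<And>B B'. \<lbrakk>B \<in> \<B>; B' \<in> \<B>\<rbrakk> \<Longrightarrow> \<exists>C\<in>\<B>. {b + b' | b b'. b \<in> B \<and> b' \<in> B'} \<subseteq> C"
    and localize: "\<And>B \<kappa> \<gamma> f. \<lbrakk>B \<in> \<B>; \<kappa> \<in> \<K>; \<gamma> \<in> \<G>; \<kappa> \<subseteq> \<gamma>; f \<in> range_in \<F> B\<rbrakk> \<Longrightarrow>
      \<exists>a\<in>range_in \<F> B. supported_by \<K> a \<gamma> \<and> (\<forall>s\<in>\<kappa>. f s = a s)"
    and l: "l 0 = 0" "hammerstein (generated_field \<K> \<G>) \<F> l"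
    and qp: "\<And>B. B \<in> \<B> \<Longrightarrow> \<exists>E. quasi_perfect E \<and> l ` range_in \<F> B \<subseteq> E"
  shows "s_bounded \<K> \<G> \<B> \<F> l"
  unfolding s_bounded_def
proof (intro ballI allI impI)
  fix B and W :: "('z \<times> 'z) set" and G :: "nat \<Rightarrow> 's set"
  assume B: "B \<in> \<B>" and W: "W \<in> unif_base" and "(\<forall>n. G n \<in> \<G>) \<and> disjoint_family G"
  then have G: "\<And>n. G n \<in> \<G>" "disjoint_family G" by auto
  interpret E: algebra UNIV "generated_field \<K> \<G>"
    by (rule algebra_generated_field)
  have l_add: "E_additive \<K> (generated_field \<K> \<G>) \<F> l"
    using hammerstein_imp_E_additive[OF l(2) zero(1) l(1)] .
  obtain C where C: "C \<in> \<B>" and "{b + b' | b b'. b \<in> B \<and> b' \<in> B} \<subseteq> C"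
    using B_plus[OF B B] by blast
  then have C_add: "b + b' \<in> C" if "b \<in> B" "b' \<in> B" for b b'
    using that by blast
  \<comment> \<open>\<open>C\<close> contains \<open>B\<close> as well, because \<open>0 \<in> B\<close>; so it serves both for \<open>a n\<close> and for \<open>a n + g n\<close>.\<close>
  have BC: "B \<subseteq> C"
    using C_add[OF _ zero(2)[OF B]] by auto
  obtain E where E: "quasi_perfect E" "l ` range_in \<F> C \<subseteq> E"
    using qp[OF C] by blast
  obtain D where D: "eventually D uniformity" "\<And>x y z. D (x, y) \<Longrightarrow> D (y, z) \<Longrightarrow> (x, z) \<in> W"
    using W uniformity_transE[of "\<lambda>p. p \<in> W"] unfolding unif_base_def by blast
  define P where "P x \<longleftrightarrow> D (x, 0) \<and> D (0, x)" for x
  have "eventually (\<lambda>(x, y). D (y, x)) uniformity"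
    using D(1) by (rule uniformity_sym)
  then have "eventually (\<lambda>x. D (x, 0)) (nhds 0)"
    unfolding eventually_nhds_uniformity by (rule eventually_mono) auto
  moreover have "eventually (\<lambda>x. D (0, x)) (nhds 0)"
    unfolding eventually_nhds_uniformity using D(1) by (rule eventually_mono) auto
  ultimately have P: "eventually P (nhds 0)"
    unfolding P_def by (rule eventually_conj)
  define bad where "bad n f g \<longleftrightarrow> f \<in> range_in \<F> B \<and> g \<in> range_in \<F> B \<and>
      supported_by \<K> g (G n) \<and> (l f, l (f + g)) \<notin> W" for n f g
  define I where "I = {n. \<exists>f g. bad n f g}"
  have "\<exists>a b. a \<in> range_in \<F> C \<and> supported_by \<K> a (G n) \<and>
      b \<in> range_in \<F> C \<and> supported_by \<K> b (G n) \<and> (l a, l b) \<notin> W" if "n \<in> I" for n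
  proof -
    from that obtain f g where f: "f \<in> range_in \<F> B" and g: "g \<in> range_in \<F> B"
      and g_supp: "supported_by \<K> g (G n)" and far: "(l f, l (f + g)) \<notin> W"
      unfolding I_def bad_def by blast
    from g_supp obtain \<kappa> where \<kappa>: "\<kappa> \<in> \<K>" "\<kappa> \<subseteq> G n" "\<forall>s\<in>- \<kappa>. g s = 0"
      unfolding supported_by_def by blast
    obtain a where a: "a \<in> range_in \<F> B" "supported_by \<K> a (G n)" "\<forall>s\<in>\<kappa>. f s = a s"
      using localize[OF B \<kappa>(1) G(1) \<kappa>(2) f] by blast
    have "\<kappa> \<in> generated_field \<K> \<G>"
      using \<kappa>(1) subset_generated_field by blast
    moreover from this have "- \<kappa> \<in> generated_field \<K> \<G>"
      using E.compl_sets by (simp add: Compl_eq_Diff_UNIV)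
    ultimately have eq: "l (f + g) - l f = l (a + g) - l a"
      using f g a \<kappa>(3) diff by (intro hammerstein_localize[OF l(2)]) (auto simp: range_in_def)
    have "(l a, l (a + g)) \<notin> W"
    proof
      assume "(l a, l (a + g)) \<in> W"
      then have "(l a + (l f - l a), l (a + g) + (l f - l a)) \<in> W"
        using W unfolding unif_base_def by blast
      moreover have "l (a + g) + (l f - l a) = l (f + g)"
        using eq by (simp add: algebra_simps)
      ultimately show False
        using far by simp
    qed
    moreover have "a \<in> range_in \<F> C" "a + g \<in> range_in \<F> C"
      using a(1) g BC C_add add by (auto simp: range_in_def image_subset_iff)
    ultimately show ?thesis
      using a(2) supported_by_add[OF a(2) g_supp] by blast
  qed
  then obtain a b where
      a: "\<And>n. n \<in> I \<Longrightarrow> a n \<in> range_in \<F> C" "\<And>n. n \<in> I \<Longrightarrow> supported_by \<K> (a n) (G n)"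
    and b: "\<And>n. n \<in> I \<Longrightarrow> b n \<in> range_in \<F> C" "\<And>n. n \<in> I \<Longrightarrow> supported_by \<K> (b n) (G n)"
    and far: "\<And>n. n \<in> I \<Longrightarrow> (l (a n), l (b n)) \<notin> W"
    by metis
  note vanish = disjoint_supports_vanish[OF zero(1) zero(2)[OF C] add l(1) l_add G]
  have "finite {n \<in> I. \<not> P (l (a n))}" "finite {n \<in> I. \<not> P (l (b n))}"
    using vanish[OF _ _ a E P] vanish[OF _ _ b E P] by blast+
  moreover have "I \<subseteq> {n \<in> I. \<not> P (l (a n))} \<union> {n \<in> I. \<not> P (l (b n))}"
    using far D(2) unfolding P_def by blast
  ultimately have "finite I"
    by (meson finite_UnI finite_subset)
  then obtain m where "\<forall>n\<in>I. n \<le> m"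
    by (meson finite_nat_set_iff_bounded_le)
  then show "\<exists>m. \<forall>n>m. \<forall>f\<in>range_in \<F> B. \<forall>g\<in>range_in \<F> B.
      supported_by \<K> g (G n) \<longrightarrow> (l f, l (f + g)) \<in> W"
    unfolding I_def bad_def by (metis (mono_tags, lifting) mem_Collect_eq not_le)
qed

section \<open>Hammerstein maps with quasi-perfect range\<close>

theorem mainTheorem3:
  fixes scaleX :: "'k::real_normed_field \<Rightarrow>
      'x::{uniform_topological_group_add, ab_group_add, t2_space} \<Rightarrow> 'x"
    and scaleZ :: "'l::real_normed_field \<Rightarrow>
      'z::{uniform_topological_group_add, ab_group_add, t2_space} \<Rightarrow> 'z"
    and \<K> \<G> :: "'s::t2_space set set"
    and \<B> :: "'x set set"
    and \<F> :: "('s \<Rightarrow> 'x) set"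
    and \<T> :: "(('s \<Rightarrow> 'x) \<times> ('s \<Rightarrow> 'x)) filter"
    and l :: "('s \<Rightarrow> 'x) \<Rightarrow> 'z"
  assumes "riesz_system \<K> \<G> \<B> \<F> \<T>"
    and "quasi_normal \<K> \<G>"
    and "topological_vector_space scaleX"
    and "\<B> = {B. closed B \<and> balanced scaleX B \<and> totally_bounded B}"
    and "\<F> \<subseteq> Cp"
    and "tvs_on (fun_scale scaleX) \<F> \<T>"
    and "unital_module_over_Cp scaleX \<F>"
    and "tensor_CK scaleX \<K> \<subseteq> \<F>"
    and "uniform_convergence_on \<F> \<le> \<T>"
    and "topological_vector_space scaleZ"
    and "l 0 = 0"
    and "hammerstein (generated_field \<K> \<G>) \<F> l"
    and "\<And>B. B \<in> \<B> \<Longrightarrow> uniformly_continuous_wrt \<T> (range_in \<F> B) l"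
    and "\<And>B. B \<in> \<B> \<Longrightarrow>
      \<exists>E. quasi_perfect E \<and> relatively_complete E \<and> l ` range_in \<F> B \<subseteq> E"
  shows "riesz_integral \<K> \<G> \<B> \<F> \<T> l"
proof -
  interpret riesz_system \<K> \<G> \<B> \<F> \<T> by fact
  have F: "0 \<in> \<F>" "\<And>f g. \<lbrakk>f \<in> \<F>; g \<in> \<F>\<rbrakk> \<Longrightarrow> f + g \<in> \<F>" "\<And>f. f \<in> \<F> \<Longrightarrow> - f \<in> \<F>"
    using assms(7) unfolding unital_module_over_Cp_def by auto
  have "s_bounded \<K> \<G> \<B> \<F> l"
  proof (rule s_bounded_if_localizable[OF F(1) _ F(2) _ B_plus])
    show "0 \<in> B" if "B \<in> \<B>" for B
      using that zero_in_B by blast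
    show "f - g \<in> \<F>" if "f \<in> \<F>" "g \<in> \<F>" for f g
      using F(2)[OF that(1) F(3)[OF that(2)]] by simp
    show "\<exists>a\<in>range_in \<F> B. supported_by \<K> a \<gamma> \<and> (\<forall>s\<in>\<kappa>. f s = a s)"
      if "B \<in> \<B>" "\<kappa> \<in> \<K>" "\<gamma> \<in> \<G>" "\<kappa> \<subseteq> \<gamma>" "f \<in> range_in \<F> B" for B \<kappa> \<gamma> f
      using F_decomposition[OF that(1), of "{\<gamma>}" \<kappa> f] that(2-5) by auto
    show "\<exists>E. quasi_perfect E \<and> l ` range_in \<F> B \<subseteq> E" if "B \<in> \<B>" for B
      using assms(14)[OF that] by blast
  qed (use assms(11,12) in auto)
  moreover have "relatively_complete (l ` range_in \<F> B)" if "B \<in> \<B>" for B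
    using assms(14)[OF that] relatively_complete_subset by blast
  ultimately show ?thesis
    unfolding riesz_integral_def
    using assms(11,13) hammerstein_imp_E_additive[OF assms(12) F(1) assms(11)] by blast
qed

end
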